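(* Let $d\ge 2$ be an integer and let $M$ be a strongly regular sequence. There exists a germ of function $f:x\mapsto f(x)$ of class $\mathcal{C}_M$ at the origin in $\mathbb{R}$ with the following property. Let $N$ be any sequence of real numbers that is increasing with $N_0=1$, logarithmically convex and of moderate growth, and suppose that there are a function germ $q$ at the origin in $\mathbb{R}\times\mathbb{R}$ and germs $r_0,\ldots,r_{d-1}$ of class $\mathcal{C}_N$ at the origin in $\mathbb{R}$ such that $$f(x)=(x^d-t^2)\,q(x,t)+\sum_{j=0}^{d-1}r_j(t)x^j$$ for $(x,t)$ in a neighborhood of the origin in $\mathbb{R}^2$. Then there is a constant $C_1>0$ such that $N_k\ge C_1^{k+1}(M_k)^{d/2}$ for all $k\in\mathbb{N}$.
   Context: A sequence $M=(M_j)_{j\ge0}$ of real numbers is strongly regular if: $M$ is increasing with $M_0=1$; $M$ is logarithmically convex ($M_{j+1}/M_j$ is increasing); (moderate growth) there is $A>0$ with $M_{j+k}\le A^{j+k}M_jM_k$ for all $j,k\in\mathbb{N}$; (strong non-quasianalyticity) there is $A>0$ with $\sum_{j\ge k}\frac{M_j}{(j+1)M_{j+1}}\le A\frac{M_k}{M_{k+1}}$ for all $k\in\mathbb{N}$. For a sequence $M$ that is increasing with $M_0=1$ and logarithmically convex, and for an open set $\Omega\subset\mathbb{R}^n$, $f$ is of class $\mathcal{C}_M$ in $\Omega$ if $f\in\mathcal{C}^\infty(\Omega)$ and for every compact $K\subset\Omega$ there is $C\ge0$ such that $|D_x^Jf(x)|\le C^{j+1}j!M_j$ for all multi-indices $J\in\mathbb{N}^n$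 of length $j$ and all $x\in K$. A germ at $0$ is of class $\mathcal{C}_M$ if it has a representative of class $\mathcal{C}_M$ in some neighborhood of $0$. *)

theory Defs
  imports "HOL-Analysis.Analysis"
begin

definition weight_sequence :: "(nat \<Rightarrow> real) \<Rightarrow> bool" where
  "weight_sequence M \<longleftrightarrow> M 0 = 1 \<and> mono M \<and> mono (\<lambda>j. M (Suc j) / M j)"

definition moderate_growth :: "(nat \<Rightarrow> real) \<Rightarrow> bool" where
  "moderate_growth M \<longleftrightarrow> (\<exists>A>0. \<forall>j k. M (j + k) \<le> A ^ (j + k) * M j * M k)"

text \<open>The series over \<open>j \<ge> k\<close> is reindexed by \<open>j = k + i\<close>. Convergence is required
  explicitly because \<^const>\<open>suminf\<close> is unspecified on divergent series.\<close>

definition strongly_non_quasianalytic :: "(nat \<Rightarrow> real) \<Rightarrow> bool" where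
  "strongly_non_quasianalytic M \<longleftrightarrow>
     (\<exists>A>0. \<forall>k.
        summable (\<lambda>i. M (k + i) / (real (k + i + 1) * M (k + i + 1))) \<and>
        (\<Sum>i. M (k + i) / (real (k + i + 1) * M (k + i + 1))) \<le> A * (M k / M (k + 1)))"

definition strongly_regular :: "(nat \<Rightarrow> real) \<Rightarrow> bool" where
  "strongly_regular M \<longleftrightarrow>
     weight_sequence M \<and> moderate_growth M \<and> strongly_non_quasianalytic M"

text \<open>Smoothness on an open set of reals: every iterated derivative exists there. Since
  \<open>\<Omega>\<close> is open, the values of \<open>(deriv ^^ j) f\<close> on \<open>\<Omega>\<close> depend only on \<open>f\<close> on \<open>\<Omega>\<close>.\<close>

definition smooth_on_open :: "real set \<Rightarrow> (real \<Rightarrow> real) \<Rightarrow> bool" where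
  "smooth_on_open \<Omega> f \<longleftrightarrow>
     open \<Omega> \<and> (\<forall>j. \<forall>x\<in>\<Omega>. (deriv ^^ j) f differentiable (at x))"

text \<open>The one-variable case of the class \<open>C\<^sub>M\<close>: a multi-index of length \<open>j\<close> is just \<open>j\<close>.\<close>

definition of_class :: "(nat \<Rightarrow> real) \<Rightarrow> real set \<Rightarrow> (real \<Rightarrow> real) \<Rightarrow> bool" where
  "of_class M \<Omega> f \<longleftrightarrow>
     smooth_on_open \<Omega> f \<and>
     (\<forall>K. compact K \<and> K \<subseteq> \<Omega> \<longrightarrow>
        (\<exists>C\<ge>0. \<forall>j. \<forall>x\<in>K. \<bar>(deriv ^^ j) f x\<bar> \<le> C ^ (j + 1) * fact j * M j))"

text \<open>A germ at the origin is represented by a total function, whose values away from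
  the origin are irrelevant.\<close>

definition germ_of_class :: "(nat \<Rightarrow> real) \<Rightarrow> (real \<Rightarrow> real) \<Rightarrow> bool" where
  "germ_of_class M f \<longleftrightarrow> (\<exists>\<Omega>. open \<Omega> \<and> 0 \<in> \<Omega> \<and> of_class M \<Omega> f)"

end

(* With m_k = k! M_k and mu_k = m_(k+1) / m_k, the series
     f(x) = sum over k of m_k (2 mu_k)^(-k) (cos + sin)(2 mu_k x)
   is of class C_M and |f^(n)(0)| >= m_n for every n, since log-convexity gives
   m_k mu_k^(n-k) <= m_n and at 0 all terms of f^(n) have the same sign.
   On the real curves t = x^(d/2) and t = -x^(d/2), x > 0, the quotient q disappears. Averaging
   the two identities leaves only even powers t^(2k) = x^(dk), so that uniqueness of asymptotic
   expansions at 0+ yields f^(dk)(0) / (dk)! = r_0^(2k)(0) / (2k)!. Hence M_k^d <= M_(dk) is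
   at most C^(2k+1) N_(2k), and N_(2k) is bounded by A^(2k) N_k^2. *)
theory Submission
  imports Defs
begin

section \<open>Inequalities for weight sequences from log-convexity\<close>

lemma weight_sequence_ge_1: "weight_sequence M \<Longrightarrow> 1 \<le> M k"
  unfolding weight_sequence_def by (metis le0 monoD)

text \<open>Raising \<open>j\<close> by one multiplies the left side by
  \<open>M (Suc j) / M j\<close> and the right side by the ratio at \<open>j + k\<close>, which is
  at least as large by log-convexity. The induction starts from \<open>M 0 = 1\<close>.\<close>

lemma weight_sequence_supermultiplicative:
  assumes "weight_sequence M"
  shows "M j * M k \<le> M (j + k)"
proof (induction j)
  case 0
  then show ?case using assms by (simp add: weight_sequence_def)
next
  case (Suc j)
  have pos: "M i > 0" for i
    using weight_sequence_ge_1[OF assms, of i] by simp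
  have "M (Suc j) * M k = M j * M k * (M (Suc j) / M j)"
    using pos[of j] by simp
  also have "\<dots> \<le> M (j + k) * (M (Suc (j + k)) / M (j + k))"
  proof (rule mult_mono)
    show "M (Suc j) / M j \<le> M (Suc (j + k)) / M (j + k)"
      using assms monoD[of "\<lambda>j. M (Suc j) / M j" j "j + k"] by (simp add: weight_sequence_def)
  qed (use Suc pos in \<open>auto intro: less_imp_le\<close>)
  also have "\<dots> = M (Suc j + k)"
    using pos[of "j + k"] by simp
  finally show ?case .
qed

lemma weight_sequence_power_le:
  assumes "weight_sequence M"
  shows "M k ^ d \<le> M (d * k)"
proof (induction d)
  case 0
  then show ?case using assms by (simp add: weight_sequence_def)
next
  case (Suc d)
  have "M k ^ Suc d \<le> M k * M (d * k)"
    using Suc weight_sequence_ge_1[OF assms, of k] by (simp add: mult_left_mono)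
  also have "\<dots> \<le> M (Suc d * k)"
    using weight_sequence_supermultiplicative[OF assms, of k "d * k"] by simp
  finally show ?case .
qed

text \<open>The sequence \<open>log m\<close> is convex with slopes \<open>log \<rho>\<close>, so
  the line through its point at \<open>k\<close> with slope \<open>log (\<rho> k)\<close> stays
  below it on both sides of \<open>k\<close>. The factor \<open>\<rho> k ^ k\<close> on the right
  avoids the exponent \<open>n - k\<close>, which may be negative.\<close>

lemma log_convex_tangent:
  fixes m \<rho> :: "nat \<Rightarrow> real"
  assumes m: "\<And>j. m (Suc j) = m j * \<rho> j" and pos: "\<And>j. m j > 0" "\<And>j. \<rho> j > 0"
    and "mono \<rho>"
  shows "m k * \<rho> k ^ n \<le> m n * \<rho> k ^ k"
proof (cases "k \<le> n")
  case True
  then show ?thesis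
  proof (induction n rule: dec_induct)
    case (step n)
    have "m k * \<rho> k ^ Suc n = m k * \<rho> k ^ n * \<rho> k" by simp
    also have "\<dots> \<le> (m n * \<rho> k ^ k) * \<rho> n"
      using step pos monoD[OF \<open>mono \<rho>\<close>, of k n]
      by (intro mult_mono[of _ _ "\<rho> k"]) (auto simp: less_imp_le)
    finally show ?case by (simp add: m mult_ac)
  qed simp
next
  case False
  then have "n \<le> k" by simp
  then show ?thesis
  proof (induction n rule: inc_induct)
    case (step n)
    \<comment> \<open>Downward step: the bound at \<open>Suc n\<close> brings in the slope
      \<open>\<rho> n\<close>, which is at most \<open>\<rho> k\<close>; one factor
      \<open>\<rho> k\<close> is then cancelled.\<close>
    have "m k * \<rho> k ^ n * \<rho> k \<le> m n * \<rho> k ^ k * \<rho> n"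
      using step.IH by (simp add: m mult_ac)
    also have "\<dots> \<le> m n * \<rho> k ^ k * \<rho> k"
      using pos monoD[OF \<open>mono \<rho>\<close>, of n k] step
      by (intro mult_left_mono) (auto simp: less_imp_le)
    finally show ?case using pos(2)[of k] by simp
  qed simp
qed

section \<open>A function of class \<open>M\<close> with large derivatives at the origin\<close>

lemma abs_cos_plus_sin_le: "\<bar>cos x + sin x\<bar> \<le> (2::real)"
  using abs_cos_le_one[of x] abs_sin_le_one[of x] by linarith

text \<open>The expression inside the absolute value is the \<open>n\<close>-th derivative of
  \<open>cos + sin\<close> at 0. For \<open>cos\<close> or \<open>sin\<close> alone, every second
  derivative would vanish there. The square is \<open>1 + sin (n * pi)\<close>, hence 1.\<close>

lemma abs_cos_plus_sin_half_pi: "\<bar>cos (real n * pi / 2) + sin (real n * pi / 2)\<bar> = 1"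
proof -
  have "(cos (real n * pi / 2) + sin (real n * pi / 2))\<^sup>2 = 1 + sin (2 * (real n * pi / 2))"
    unfolding sin_double power2_sum using sin_cos_squared_add[of "real n * pi / 2"]
    by (simp add: algebra_simps)
  also have "\<dots> = 1\<^sup>2" by simp
  finally show ?thesis by (metis power2_eq_iff abs_one abs_minus_cancel)
qed

lemma ex_of_class_large_derivatives:
  assumes M: "weight_sequence M"
  obtains f where "of_class M UNIV f" "\<And>n. fact n * M n \<le> \<bar>(deriv ^^ n) f 0\<bar>"
proof -
  define m where "m = (\<lambda>k. fact k * M k)"
  define \<rho> where "\<rho> = (\<lambda>k. real (Suc k) * (M (Suc k) / M k))"
  have Mpos: "M i > 0" for i
    using weight_sequence_ge_1[OF M, of i] by simp
  have pos: "m k > 0" "\<rho> k > 0" for k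
    using Mpos by (simp_all add: m_def \<rho>_def)
  have m: "m (Suc k) = m k * \<rho> k" for k
    using Mpos[of k] by (simp add: m_def \<rho>_def)
  have "mono \<rho>"
  proof (rule monoI)
    fix i j :: nat assume "i \<le> j"
    then have "M (Suc i) / M i \<le> M (Suc j) / M j"
      using M monoD[of "\<lambda>j. M (Suc j) / M j" i j] by (simp add: weight_sequence_def)
    then show "\<rho> i \<le> \<rho> j"
      unfolding \<rho>_def using \<open>i \<le> j\<close> Mpos by (intro mult_mono) (auto intro: less_imp_le)
  qed
  \<comment> \<open>Amplitude of the \<open>k\<close>-th summand after \<open>n\<close>
    differentiations, each of which contributes the frequency \<open>2 * \<rho> k\<close>. The
    tangent inequality bounds it by \<open>m n * 2 ^ n / 2 ^ k\<close>: the 2 in the frequency is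
    what makes the series converge geometrically.\<close>
  define c where "c = (\<lambda>n k. m k / (2 * \<rho> k) ^ k * (2 * \<rho> k) ^ n)"
  have c_pos: "c n k > 0" for n k
    using pos by (simp add: c_def)
  have c_le: "c n k \<le> 2 ^ n * m n * (1 / 2) ^ k" for n k
  proof -
    have "c n k = 2 ^ n * (m k * \<rho> k ^ n) / (2 ^ k * \<rho> k ^ k)"
      by (simp add: c_def power_mult_distrib)
    also have "\<dots> \<le> 2 ^ n * (m n * \<rho> k ^ k) / (2 ^ k * \<rho> k ^ k)"
      using log_convex_tangent[OF m pos \<open>mono \<rho>\<close>, of k n] pos(2)[of k]
      by (intro divide_right_mono mult_left_mono) auto
    also have "\<dots> = 2 ^ n * m n * (1 / 2) ^ k"
      using pos(2)[of k] by (simp add: power_divide)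
    finally show ?thesis .
  qed
  have geom: "summable (\<lambda>k. 2 ^ n * m n * (1 / 2 :: real) ^ k)" for n
    by (intro summable_mult summable_geometric) simp
  \<comment> \<open>The \<open>n\<close>-th derivative of \<open>cos + sin\<close>, written as a
    phase shift by \<open>n\<close> quarter turns.\<close>
  define \<phi> where "\<phi> = (\<lambda>n y. cos (y + real n * pi / 2) + sin (y + real n * pi / 2))"
  define g where "g = (\<lambda>n k x. c n k * \<phi> n (2 * \<rho> k * x))"
  have \<phi>_deriv: "(\<phi> n has_field_derivative \<phi> (Suc n) y) (at y)" for n y
  proof -
    have "y + real (Suc n) * pi / 2 = (y + real n * pi / 2) + pi / 2"
      by (simp add: field_simps)
    then have "\<phi> (Suc n) y = - sin (y + real n * pi / 2) + cos (y + real n * pi / 2)"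
      unfolding \<phi>_def by (simp only: cos_add sin_add) simp
    then show ?thesis
      unfolding \<phi>_def by (auto intro!: derivative_eq_intros)
  qed
  have g_deriv: "(g n k has_field_derivative g (Suc n) k x) (at x)" for n k x
  proof -
    have "((\<lambda>x. \<phi> n (2 * \<rho> k * x)) has_field_derivative \<phi> (Suc n) (2 * \<rho> k * x) * (2 * \<rho> k)) (at x)"
      by (rule DERIV_chain2[OF \<phi>_deriv]) (auto intro!: derivative_eq_intros)
    from DERIV_cmult[OF this, of "c n k"] show ?thesis
      by (simp add: g_def c_def mult_ac)
  qed
  have g_le: "\<bar>g n k x\<bar> \<le> 2 * (2 ^ n * m n * (1 / 2) ^ k)" for n k x
  proof -
    have "\<bar>g n k x\<bar> = c n k * \<bar>\<phi> n (2 * \<rho> k * x)\<bar>"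
      using c_pos[of n k] by (simp add: g_def abs_mult)
    also have "\<dots> \<le> c n k * 2"
      unfolding \<phi>_def using c_pos[of n k] by (intro mult_left_mono abs_cos_plus_sin_le) auto
    finally show ?thesis using c_le[of n k] by linarith
  qed
  \<comment> \<open>The majorant does not depend on \<open>x\<close>, so the differentiated series
    converges uniformly for every \<open>n\<close>; this justifies termwise differentiation to all
    orders.\<close>
  have unif: "uniformly_convergent_on UNIV (\<lambda>K x. \<Sum>k<K. g n k x)" for n
    using g_le geom by (intro Weierstrass_m_test'[where M = "\<lambda>k. 2 * (2 ^ n * m n * (1 / 2) ^ k)"] summable_mult) auto
  have g_sum: "summable (\<lambda>k. g n k x)" for n x
    by (rule summable_comparison_test'[OF summable_mult[OF geom[of n], of 2], of 0])
      (use g_le in auto)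
  define F where "F = (\<lambda>n x. \<Sum>k. g n k x)"
  have F_deriv: "(F n has_field_derivative F (Suc n) x) (at x)" for n x
    unfolding F_def
    by (rule has_field_derivative_series'(2)[of UNIV "g n" "g (Suc n)" 0])
      (use g_deriv unif g_sum in auto)
  have deriv_F: "(deriv ^^ n) (F 0) = F n" for n
    by (induction n) (auto intro!: ext DERIV_imp_deriv F_deriv)
  \<comment> \<open>One factor 2 bounds \<open>cos + sin\<close>, another is the sum of the
    geometric series, and \<open>2 ^ n \<le> 4 ^ n\<close>; so the constant 4 serves on every
    compact set.\<close>
  have F_le: "\<bar>F n x\<bar> \<le> 4 ^ (n + 1) * fact n * M n" for n x
  proof -
    have "\<bar>F n x\<bar> \<le> (\<Sum>k. 2 * (2 ^ n * m n * (1 / 2) ^ k))"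
      unfolding F_def real_norm_def[symmetric]
      by (rule norm_suminf_le) (use g_le geom in \<open>auto intro: summable_mult\<close>)
    also have "\<dots> = 2 * (2 ^ n * m n * 2)"
      by (simp add: suminf_mult summable_mult suminf_geometric)
    also have "\<dots> = (2 ^ n * 4) * m n" by simp
    also have "\<dots> \<le> (4 ^ n * 4) * m n"
      using pos(1)[of n] by (intro mult_right_mono power_mono) auto
    finally show ?thesis by (simp add: m_def mult_ac)
  qed
  have F_ge: "fact n * M n \<le> \<bar>F n 0\<bar>" for n
  proof -
    have c_sum: "summable (c n)"
      by (rule summable_comparison_test'[OF geom[of n], of 0])
        (use c_le c_pos in \<open>auto simp: abs_of_pos\<close>)
    \<comment> \<open>At 0 all summands share the factor \<open>\<phi> n 0\<close>, of absolute
      value 1, and have positive amplitudes. The sum therefore dominates its single term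
      \<open>k = n\<close>, where the powers of \<open>2 * \<rho> k\<close> cancel.\<close>
    have "m n = c n n" using pos[of n] by (simp add: c_def)
    also have "\<dots> = (\<Sum>k\<in>{n}. c n k)" by simp
    also have "\<dots> \<le> (\<Sum>k. c n k)"
      using c_pos by (intro sum_le_suminf c_sum) (auto intro: less_imp_le)
    also have "\<dots> \<le> \<bar>(\<Sum>k. c n k) * \<phi> n 0\<bar>"
      using abs_cos_plus_sin_half_pi[of n] by (simp add: abs_mult \<phi>_def)
    also have "(\<Sum>k. c n k) * \<phi> n 0 = F n 0"
      by (simp add: F_def g_def suminf_mult2[OF c_sum])
    finally show ?thesis by (simp add: m_def)
  qed
  have "of_class M UNIV (F 0)"
    unfolding of_class_def smooth_on_open_def deriv_F
  proof (intro conjI allI ballI impI)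
    show "F j differentiable at x" for j x
      using F_deriv real_differentiable_def by blast
    show "\<exists>C\<ge>0. \<forall>j. \<forall>x\<in>K. \<bar>F j x\<bar> \<le> C ^ (j + 1) * fact j * M j" for K
      using F_le by (intro exI[of _ 4]) auto
  qed auto
  then show thesis
    using that[of "F 0"] F_ge by (simp add: deriv_F)
qed

section \<open>Taylor expansions of germs and of their even parts\<close>

lemma germ_of_class_Taylor:
  assumes "germ_of_class M f"
  obtains B where
    "\<forall>\<^sub>F x in nhds 0. \<bar>f x - (\<Sum>i<n. (deriv ^^ i) f 0 / fact i * x ^ i)\<bar> \<le> B * \<bar>x\<bar> ^ n"
proof -
  obtain \<Omega> where \<Omega>: "open \<Omega>" "0 \<in> \<Omega>" "of_class M \<Omega> f"
    using assms by (auto simp: germ_of_class_def)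
  obtain e where e: "e > 0" "cball 0 e \<subseteq> \<Omega>"
    using \<Omega> open_contains_cball by blast
  obtain C where C: "\<And>x. x \<in> cball 0 e \<Longrightarrow> \<bar>(deriv ^^ n) f x\<bar> \<le> C ^ (n + 1) * fact n * M n"
  proof -
    have "\<forall>K. compact K \<and> K \<subseteq> \<Omega> \<longrightarrow> (\<exists>C\<ge>0. \<forall>j. \<forall>x\<in>K. \<bar>(deriv ^^ j) f x\<bar> \<le> C ^ (j + 1) * fact j * M j)"
      using \<Omega>(3) by (simp add: of_class_def)
    then obtain C where "\<forall>j. \<forall>x\<in>cball 0 e. \<bar>(deriv ^^ j) f x\<bar> \<le> C ^ (j + 1) * fact j * M j"
      using e(2) compact_cball by meson
    then show thesis using that by blast
  qed
  \<comment> \<open>The factorial in the class estimate cancels the one in the Lagrange remainder.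
    \<open>B\<close> may depend on \<open>n\<close>, which is fixed, but not on
    \<open>x\<close>.\<close>
  define B where "B = C ^ (n + 1) * M n"
  have "\<bar>f x - (\<Sum>i<n. (deriv ^^ i) f 0 / fact i * x ^ i)\<bar> \<le> B * \<bar>x\<bar> ^ n" if "x \<in> ball 0 e" for x
  proof -
    have "\<forall>i t. i < n \<and> \<bar>t\<bar> \<le> \<bar>x\<bar> \<longrightarrow> DERIV ((deriv ^^ i) f) t :> (deriv ^^ Suc i) f t"
    proof (intro allI impI)
      fix i t assume "i < n \<and> \<bar>t\<bar> \<le> \<bar>x\<bar>"
      then have "t \<in> \<Omega>" using that e by (auto simp: subset_iff)
      then have "(deriv ^^ i) f differentiable (at t)"
        using \<Omega>(3) by (auto simp: of_class_def smooth_on_open_def)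
      then show "DERIV ((deriv ^^ i) f) t :> (deriv ^^ Suc i) f t"
        by (simp add: DERIV_deriv_iff_real_differentiable)
    qed
    from Maclaurin_bi_le[OF _ this, of f] obtain t where t: "\<bar>t\<bar> \<le> \<bar>x\<bar>"
      "f x = (\<Sum>i<n. (deriv ^^ i) f 0 / fact i * x ^ i) + (deriv ^^ n) f t / fact n * x ^ n"
      by auto
    have "\<bar>(deriv ^^ n) f t / fact n * x ^ n\<bar> \<le> B * \<bar>x\<bar> ^ n"
      unfolding abs_mult abs_divide power_abs B_def using C[of t] t that
      by (intro mult_right_mono) (auto simp: field_simps)
    then show ?thesis using t by simp
  qed
  moreover have "\<forall>\<^sub>F x in nhds 0. x \<in> ball (0::real) e"
    using e by (intro eventually_nhds_in_open) auto
  ultimately show thesis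
    by (intro that[of B]) (rule eventually_mono)
qed

text \<open>Averaging the order \<open>2 * n\<close> expansions at \<open>x\<close> and
  \<open>- x\<close> cancels the odd powers and keeps the order of the remainder.\<close>

lemma germ_of_class_even_Taylor:
  assumes "germ_of_class M f"
  obtains B where
    "\<forall>\<^sub>F x in nhds 0. \<bar>(f x + f (- x)) / 2 - (\<Sum>k<n. (deriv ^^ (2 * k)) f 0 / fact (2 * k) * x ^ (2 * k))\<bar>
       \<le> B * \<bar>x\<bar> ^ (2 * n)"
proof -
  define a where "a = (\<lambda>i. (deriv ^^ i) f 0 / fact i)"
  obtain B where B: "\<forall>\<^sub>F x in nhds 0. \<bar>f x - (\<Sum>i<2*n. a i * x ^ i)\<bar> \<le> B * \<bar>x\<bar> ^ (2*n)"
    using germ_of_class_Taylor[OF assms, of "2 * n"] unfolding a_def by blast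
  have "filterlim (\<lambda>x::real. - x) (nhds 0) (nhds 0)"
    using tendsto_minus[OF filterlim_ident, of "0::real"] by simp
  from eventually_compose_filterlim[OF B this]
  have B': "\<forall>\<^sub>F x in nhds 0. \<bar>f (- x) - (\<Sum>i<2*n. a i * (- x) ^ i)\<bar> \<le> B * \<bar>x\<bar> ^ (2*n)"
    by simp
  have even: "(\<Sum>i<2*n. a i * x ^ i) + (\<Sum>i<2*n. a i * (- x) ^ i) = 2 * (\<Sum>k<n. a (2*k) * x ^ (2*k))" for x
    by (induction n) (simp_all add: distrib_left)
  have "\<forall>\<^sub>F x in nhds 0. \<bar>(f x + f (- x)) / 2 - (\<Sum>k<n. a (2*k) * x ^ (2*k))\<bar> \<le> B * \<bar>x\<bar> ^ (2*n)"
    using B B'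
  proof eventually_elim
    case (elim x)
    then show ?case using even[of x] by (simp add: abs_le_iff field_simps)
  qed
  then show thesis using that[of B] by (simp add: a_def)
qed

section \<open>Uniqueness of one-sided expansions and comparison of coefficients\<close>

lemma coeff_eq_0_if_poly_bigo:
  fixes p :: "real poly"
  assumes "\<forall>\<^sub>F x in at_right 0. \<bar>poly p x\<bar> \<le> B * x ^ n" "i < n"
  shows "coeff p i = 0"
  using assms
proof (induction n arbitrary: p i)
  case (Suc n)
  have "((\<lambda>x. poly p x) \<longlongrightarrow> poly p 0) (at_right 0)"
    by (intro tendsto_intros)
  moreover have "((\<lambda>x. B * x ^ Suc n) \<longlongrightarrow> B * 0 ^ Suc n) (at_right (0::real))"
    by (intro tendsto_intros)
  then have "((\<lambda>x. poly p x) \<longlongrightarrow> 0) (at_right 0)"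
    using Suc.prems(1) by (intro Lim_null_comparison[of "poly p"]) auto
  ultimately have "poly p 0 = 0"
    using tendsto_unique by (metis trivial_limit_at_right_real)
  moreover obtain a q where p: "p = pCons a q" by (cases p)
  ultimately have a: "a = 0" by simp
  \<comment> \<open>The constant term vanishes, so \<open>p\<close> is \<open>x\<close> times
    \<open>q\<close>. Dividing by \<open>x > 0\<close> lowers the order of the bound by one and
    shifts the coefficients.\<close>
  have "\<forall>\<^sub>F x in at_right 0. \<bar>poly q x\<bar> \<le> B * x ^ n"
    using Suc.prems(1) eventually_at_right_less[of 0]
    by eventually_elim (auto simp: p a abs_mult mult_ac)
  then show ?case
    using Suc.IH[of q] Suc.prems(2) by (cases i) (auto simp: p a)
qed simp

lemma division_by_binomial_coefficient:
  fixes f :: "real \<Rightarrow> real" and q :: "real \<Rightarrow> real \<Rightarrow> real" and r :: "nat \<Rightarrow> real \<Rightarrow> real"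
  assumes d: "d > 0" and f: "germ_of_class M f" and r: "\<forall>j<d. germ_of_class N (r j)"
    and eq: "\<forall>\<^sub>F (x, t) in nhds (0, 0). f x = (x ^ d - t ^ 2) * q x t + (\<Sum>j<d. r j t * x ^ j)"
  shows "(deriv ^^ (d * k)) f 0 / fact (d * k) = (deriv ^^ (2 * k)) (r 0) 0 / fact (2 * k)"
proof -
  \<comment> \<open>The least truncation order for which the degree \<open>d * k\<close> lies
    strictly below the remainder order \<open>d * n\<close>.\<close>
  define n where "n = Suc k"
  define b where "b = (\<lambda>i. (deriv ^^ i) f 0 / fact i)"
  define a where "a = (\<lambda>j i. (deriv ^^ (2 * i)) (r j) 0 / fact (2 * i))"
  \<comment> \<open>Difference of the truncated expansions of the two sides along the curves. Since
    \<open>t ^ (2 * i) = x ^ (d * i)\<close>, the even parts of the \<open>r j\<close> give integer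
    powers of \<open>x\<close> even for odd \<open>d\<close>.\<close>
  define p where "p = (\<Sum>i<d*n. monom (b i) i) - (\<Sum>j<d. \<Sum>i<n. monom (a j i) (d * i + j))"
  have right: "filterlim (\<lambda>x. x) (nhds 0) (at_right (0::real))"
    by (rule tendsto_ident_at)
  have curve: "filterlim (\<lambda>x. sqrt (x ^ d)) (nhds 0) (at_right (0::real))"
    using d by (auto intro!: tendsto_eq_intros)
  have curve': "filterlim (\<lambda>x. - sqrt (x ^ d)) (nhds 0) (at_right (0::real))"
    using tendsto_minus[OF curve] by simp
  obtain B where B: "\<forall>\<^sub>F x in nhds 0. \<bar>f x - (\<Sum>i<d*n. b i * x ^ i)\<bar> \<le> B * \<bar>x\<bar> ^ (d*n)"
    using germ_of_class_Taylor[OF f, of "d * n"] unfolding b_def by blast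
  have "\<forall>j\<in>{..<d}. \<exists>B. \<forall>\<^sub>F x in nhds 0.
      \<bar>(r j x + r j (- x)) / 2 - (\<Sum>i<n. a j i * x ^ (2 * i))\<bar> \<le> B * \<bar>x\<bar> ^ (2 * n)"
  proof
    fix j assume "j \<in> {..<d}"
    then have "germ_of_class N (r j)" using r by simp
    then show "\<exists>B. \<forall>\<^sub>F x in nhds 0.
      \<bar>(r j x + r j (- x)) / 2 - (\<Sum>i<n. a j i * x ^ (2 * i))\<bar> \<le> B * \<bar>x\<bar> ^ (2 * n)"
      using germ_of_class_even_Taylor[of N "r j" n] unfolding a_def by blast
  qed
  then obtain B' where B': "\<forall>j\<in>{..<d}. \<forall>\<^sub>F x in nhds 0.
      \<bar>(r j x + r j (- x)) / 2 - (\<Sum>i<n. a j i * x ^ (2 * i))\<bar> \<le> B' j * \<bar>x\<bar> ^ (2 * n)"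
    by (rule bchoice[THEN exE])
  have r_curve: "\<forall>\<^sub>F x in at_right 0. \<forall>j\<in>{..<d}.
      \<bar>(r j (sqrt (x ^ d)) + r j (- sqrt (x ^ d))) / 2 - (\<Sum>i<n. a j i * sqrt (x ^ d) ^ (2 * i))\<bar>
        \<le> B' j * \<bar>sqrt (x ^ d)\<bar> ^ (2 * n)"
    using B' by (intro eventually_ball_finite ballI)
      (auto intro: eventually_compose_filterlim[OF _ curve])
  have eq1: "\<forall>\<^sub>F x in at_right 0. f x = (x ^ d - sqrt (x ^ d) ^ 2) * q x (sqrt (x ^ d))
      + (\<Sum>j<d. r j (sqrt (x ^ d)) * x ^ j)"
    using eventually_compose_filterlim[OF eq tendsto_Pair[OF right curve]] by simp
  have eq2: "\<forall>\<^sub>F x in at_right 0. f x = (x ^ d - sqrt (x ^ d) ^ 2) * q x (- sqrt (x ^ d))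
      + (\<Sum>j<d. r j (- sqrt (x ^ d)) * x ^ j)"
    using eventually_compose_filterlim[OF eq tendsto_Pair[OF right curve']] by simp
  have "\<forall>\<^sub>F x in at_right (0::real). x < 1"
    by (rule eventually_at_right_real[THEN eventually_mono]) auto
  with eventually_compose_filterlim[OF B right] r_curve eq1 eq2 eventually_at_right_less[of 0]
  have "\<forall>\<^sub>F x in at_right 0. \<bar>poly p x\<bar> \<le> (B + (\<Sum>j<d. B' j)) * x ^ (d * n)"
  proof eventually_elim
    case (elim x)
    define t where "t = sqrt (x ^ d)"
    have t2: "t ^ (2 * i) = x ^ (d * i)" for i
      using elim by (simp add: t_def power_mult)
    have t0: "t \<ge> 0" using elim by (simp add: t_def)
    \<comment> \<open>Taylor remainder of the even part of \<open>r j\<close> on the curve, of order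
      \<open>t ^ (2 * n) = x ^ (d * n)\<close>.\<close>
    define u where "u = (\<lambda>j. (r j t + r j (- t)) / 2 - (\<Sum>i<n. a j i * x ^ (d * i)))"
    have u: "\<bar>u j\<bar> \<le> B' j * x ^ (d * n)" if "j < d" for j
      using elim(2) that t0 unfolding t_def[symmetric] u_def t2[symmetric] by simp
    \<comment> \<open>On both curves \<open>t\<^sup>2 = x ^ d\<close>, so the coefficient of
      \<open>q\<close> is zero whatever value \<open>q\<close> takes there.\<close>
    have "f x = (\<Sum>j<d. r j t * x ^ j)" "f x = (\<Sum>j<d. r j (- t) * x ^ j)"
      using elim t2[of 1] by (simp_all add: t_def)
    then have "f x = (\<Sum>j<d. (r j t + r j (- t)) / 2 * x ^ j)"
      by (simp add: add_divide_distrib distrib_right sum.distrib sum_divide_distrib[symmetric])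
    also have "\<dots> = (\<Sum>j<d. (\<Sum>i<n. a j i * x ^ (d * i)) * x ^ j) + (\<Sum>j<d. u j * x ^ j)"
      by (simp add: u_def sum.distrib[symmetric] algebra_simps)
    finally have "poly p x = (\<Sum>j<d. u j * x ^ j) - (f x - (\<Sum>i<d*n. b i * x ^ i))"
      by (simp add: p_def poly_sum poly_monom sum_distrib_right power_add mult.assoc)
    moreover have "\<bar>\<Sum>j<d. u j * x ^ j\<bar> \<le> (\<Sum>j<d. B' j * x ^ (d * n))"
      unfolding real_norm_def[symmetric]
    proof (rule sum_norm_le)
      fix j assume "j \<in> {..<d}"
      have "\<bar>u j * x ^ j\<bar> \<le> \<bar>u j\<bar> * 1"
        unfolding abs_mult using elim by (intro mult_left_mono) (auto simp: power_le_one)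
      then show "norm (u j * x ^ j) \<le> B' j * x ^ (d * n)"
        using u[of j] \<open>j \<in> {..<d}\<close> by simp
    qed
    ultimately show ?case
      using elim(1,5) by (simp add: distrib_right sum_distrib_right)
  qed
  then have "coeff p (d * k) = 0"
    by (rule coeff_eq_0_if_poly_bigo) (use d in \<open>simp add: n_def\<close>)
  moreover have "coeff (monom (a j i) (d * i + j)) (d * k) = (if j = 0 then (if i = k then a 0 k else 0) else 0)"
    if "j < d" for i j
  proof -
    \<comment> \<open>Reduction modulo \<open>d\<close>: as \<open>j < d\<close>, only
      \<open>j = 0\<close>, and then \<open>i = k\<close>, reaches degree \<open>d * k\<close>. This
      isolates one coefficient of \<open>r 0\<close>.\<close>
    have "d * i + j = d * k \<Longrightarrow> j = 0"
      using that by (metis mod_mult_self4 mod_less mod_mult_self1_is_0 mult.commute)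
    then show ?thesis using d by auto
  qed
  then have "(\<Sum>j<d. \<Sum>i<n. coeff (monom (a j i) (d * i + j)) (d * k))
      = (\<Sum>j<d. if j = 0 then (\<Sum>i<n. if i = k then a 0 k else 0) else 0)"
    by (intro sum.cong) auto
  then have "(\<Sum>j<d. \<Sum>i<n. coeff (monom (a j i) (d * i + j)) (d * k)) = a 0 k"
    using d by (simp only: sum.delta finite_lessThan lessThan_iff n_def) simp
  then have "coeff p (d * k) = b (d * k) - a 0 k"
    using d by (simp only: p_def coeff_diff coeff_sum) (simp add: n_def)
  ultimately show ?thesis by (simp add: a_def b_def)
qed

section \<open>The lower bound for \<open>N\<close>\<close>

theorem mainTheorem2:
  fixes d :: nat and M :: "nat \<Rightarrow> real"
  assumes "d \<ge> 2" and "strongly_regular M"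
  shows "\<exists>f :: real \<Rightarrow> real. germ_of_class M f \<and>
    (\<forall>N :: nat \<Rightarrow> real. weight_sequence N \<and> moderate_growth N \<longrightarrow>
      (\<exists>(q :: real \<Rightarrow> real \<Rightarrow> real) (r :: nat \<Rightarrow> real \<Rightarrow> real).
         (\<forall>j<d. germ_of_class N (r j)) \<and>
         (\<forall>\<^sub>F (x, t) in nhds (0, 0).
            f x = (x ^ d - t ^ 2) * q x t + (\<Sum>j<d. r j t * x ^ j))) \<longrightarrow>
      (\<exists>C\<^sub>1>0. \<forall>k. N k \<ge> C\<^sub>1 ^ (k + 1) * M k powr (real d / 2)))"
proof -
  have M: "weight_sequence M" using assms by (simp add: strongly_regular_def)
  obtain f where f: "of_class M UNIV f" "\<And>n. fact n * M n \<le> \<bar>(deriv ^^ n) f 0\<bar>"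
    using ex_of_class_large_derivatives[OF M] by blast
  have germ: "germ_of_class M f"
    using f(1) unfolding germ_of_class_def by (intro exI[of _ UNIV]) auto
  show ?thesis
  proof (intro exI[of _ f] conjI germ allI impI)
    fix N :: "nat \<Rightarrow> real"
    assume N: "weight_sequence N \<and> moderate_growth N"
      and ex: "\<exists>(q :: real \<Rightarrow> real \<Rightarrow> real) (r :: nat \<Rightarrow> real \<Rightarrow> real).
         (\<forall>j<d. germ_of_class N (r j)) \<and>
         (\<forall>\<^sub>F (x, t) in nhds (0, 0).
            f x = (x ^ d - t ^ 2) * q x t + (\<Sum>j<d. r j t * x ^ j))"
    from ex obtain q r where r: "\<forall>j<d. germ_of_class N (r j)"
      and eq: "\<forall>\<^sub>F (x, t) in nhds (0, 0). f x = (x ^ d - t ^ 2) * q x t + (\<Sum>j<d. r j t * x ^ j)"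
      by blast
    have N1: "N i \<ge> 1" for i using N weight_sequence_ge_1 by blast
    have M1: "M i \<ge> 1" for i using M weight_sequence_ge_1 by blast
    have "germ_of_class N (r 0)" using r assms(1) by simp
    then obtain \<Omega> where "0 \<in> \<Omega>" "of_class N \<Omega> (r 0)"
      by (auto simp: germ_of_class_def)
    then have "\<exists>C\<ge>0. \<forall>j. \<forall>x\<in>{0}. \<bar>(deriv ^^ j) (r 0) x\<bar> \<le> C ^ (j + 1) * fact j * N j"
      unfolding of_class_def by (meson compact_sing empty_subsetI insert_subset)
    then obtain C0 where C0: "C0 \<ge> 0" "\<And>j. \<bar>(deriv ^^ j) (r 0) 0\<bar> \<le> C0 ^ (j + 1) * fact j * N j"
      by auto
    obtain A where A: "A > 0" "\<And>j k. N (j + k) \<le> A ^ (j + k) * N j * N k"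
      using N by (auto simp: moderate_growth_def)
    \<comment> \<open>Both constants are replaced by ones at least 1, so that exponents may be
      increased below. The witness for \<open>C\<^sub>1\<close> will be
      \<open>1 / D\<close>.\<close>
    define C where "C = max C0 1"
    define D where "D = C * max A 1"
    have C: "C \<ge> C0" "C \<ge> 1" by (auto simp: C_def)
    have "C * 1 \<le> D" unfolding D_def using C by (intro mult_left_mono) auto
    then have D: "D \<ge> 1" "C \<le> D" using C by auto
    have "(1 / D) ^ (k + 1) * M k powr (real d / 2) \<le> N k" for k
    proof -
      have "M k ^ d \<le> M (d * k)" by (rule weight_sequence_power_le[OF M])
      also have "\<dots> \<le> \<bar>(deriv ^^ (d * k)) f 0 / fact (d * k)\<bar>"
        using f(2)[of "d * k"] by (simp add: field_simps)
      also have "\<dots> = \<bar>(deriv ^^ (2 * k)) (r 0) 0 / fact (2 * k)\<bar>"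
        using division_by_binomial_coefficient[OF _ germ r eq] assms(1) by simp
      also have "\<dots> \<le> C0 ^ (2 * k + 1) * N (2 * k)"
        using C0(2)[of "2 * k"] by (simp add: field_simps)
      also have "\<dots> \<le> C ^ (2 * k + 1) * (A ^ (2 * k) * N k * N k)"
        using A(2)[of k k] N1[of "2 * k"] C C0 by (intro mult_mono power_mono) (auto simp: mult_2)
      \<comment> \<open>Both exponents are rounded up to \<open>2 * k + 2\<close> to make the bound
        the perfect square of \<open>D ^ (k + 1) * N k\<close>; the square root then turns
        \<open>M k ^ d\<close> into the power \<open>d / 2\<close>.\<close>
      also have "\<dots> \<le> C ^ (2 * k + 2) * (max A 1 ^ (2 * k + 2) * N k * N k)"
      proof (intro mult_mono)
        have "A ^ (2 * k) \<le> max A 1 ^ (2 * k)" using A by (intro power_mono) auto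
        also have "\<dots> \<le> max A 1 ^ (2 * k + 2)" by (intro power_increasing) auto
        finally show "A ^ (2 * k) \<le> max A 1 ^ (2 * k + 2)" .
      qed (use A C N1[of k] in \<open>auto intro: power_increasing\<close>)
      also have "\<dots> = (D ^ (k + 1) * N k)\<^sup>2"
        by (simp add: D_def power_mult_distrib power_add mult.commute[of 2] power_mult power2_eq_square mult_ac)
      finally have "sqrt (M k ^ d) \<le> D ^ (k + 1) * N k"
        using D N1[of k] by (intro real_le_lsqrt) auto
      moreover have "sqrt (M k ^ d) = M k powr (real d / 2)"
        using M1[of k] by (simp add: powr_half_sqrt[symmetric] powr_realpow[symmetric] powr_powr)
      ultimately show ?thesis
        using D by (simp add: field_simps power_divide)
    qed
    then show "\<exists>C\<^sub>1>0. \<forall>k. N k \<ge> C\<^sub>1 ^ (k + 1) * M k powr (real d / 2)"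
      using D by (intro exI[of _ "1 / D"]) auto
  qed
qed

end
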